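(* Let $G$ be a countably infinite group and let $G\curvearrowright X$ be a minimal expansive action on a compact metrizable space by homeomorphisms. Then $G\curvearrowright X$ has the topological Markov property if and only if it has no off-diagonal asymptotic pairs.
   Context: Fix a compatible metric $d$ on $X$ (the notions below do not depend on its choice). For $K\subset G$ and $x,y\in X$ write $d_K(x,y)=\sup_{g\in K}d(gx,gy)$. Minimal: every closed $G$-invariant subset of $X$ is either $X$ or empty. Expansive: there is $c>0$ such that for all $x\neq y$ in $X$ there is $g\in G$ with $d(gx,gy)>c$. Asymptotic pair: $(x,y)\in X^2$ such that for every $\varepsilon>0$ there is a finite $F\subset G$ with $d(gx,gy)\le\varepsilon$ for all $g\notin F$; it is off-diagonal if $x\neq y$. Memory set: for $\varepsilon,\delta>0$ and finite $A\subset B\subset G$, $B$ is an $(\varepsilon,\delta)$-memory set for $A$ if for every $x,y\in X$ with $d_{B\setminus A}(x,y)\le\delta$ there is $z\in X$ with $d_B(x,z)\le\varepsilon$ and $d_{G\setminus A}(y,z)\le\varepsilon$. Topological Markov property (TMP): for every $\varepsilon>0$ there is $\delta>0$ such that every finite $A\subset G$ admits an $(\varepsilon,\delta)$-memory set. *)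

theory Defs
  imports "HOL-Analysis.Analysis" "HOL-Algebra.Group_Action"
begin

definition compatible_metric :: "'x topology \<Rightarrow> ('x \<Rightarrow> 'x \<Rightarrow> real) \<Rightarrow> bool" where
  "compatible_metric X d \<longleftrightarrow>
     Metric_space (topspace X) d \<and> Metric_space.mtopology (topspace X) d = X"

definition action_by_homeos ::
    "('g, 'm) monoid_scheme \<Rightarrow> 'x topology \<Rightarrow> ('g \<Rightarrow> 'x \<Rightarrow> 'x) \<Rightarrow> bool" where
  "action_by_homeos G X \<phi> \<longleftrightarrow>
     group_action G (topspace X) \<phi> \<and> (\<forall>g\<in>carrier G. homeomorphic_map X X (\<phi> g))"

definition minimal_action ::
    "('g, 'm) monoid_scheme \<Rightarrow> 'x topology \<Rightarrow> ('g \<Rightarrow> 'x \<Rightarrow> 'x) \<Rightarrow> bool" where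
  "minimal_action G X \<phi> \<longleftrightarrow>
     (\<forall>C. closedin X C \<and> (\<forall>g\<in>carrier G. \<phi> g ` C \<subseteq> C) \<longrightarrow> C = topspace X \<or> C = {})"

definition expansive_action ::
    "('g, 'm) monoid_scheme \<Rightarrow> 'x topology \<Rightarrow> ('x \<Rightarrow> 'x \<Rightarrow> real) \<Rightarrow> ('g \<Rightarrow> 'x \<Rightarrow> 'x) \<Rightarrow> bool" where
  "expansive_action G X d \<phi> \<longleftrightarrow>
     (\<exists>c>0. \<forall>x\<in>topspace X. \<forall>y\<in>topspace X. x \<noteq> y \<longrightarrow>
        (\<exists>g\<in>carrier G. d (\<phi> g x) (\<phi> g y) > c))"

definition asymptotic_pair ::
    "('g, 'm) monoid_scheme \<Rightarrow> 'x topology \<Rightarrow> ('x \<Rightarrow> 'x \<Rightarrow> real) \<Rightarrow> ('g \<Rightarrow> 'x \<Rightarrow> 'x)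
     \<Rightarrow> 'x \<Rightarrow> 'x \<Rightarrow> bool" where
  "asymptotic_pair G X d \<phi> x y \<longleftrightarrow> x \<in> topspace X \<and> y \<in> topspace X \<and>
     (\<forall>\<epsilon>>0. \<exists>F. finite F \<and> F \<subseteq> carrier G \<and>
        (\<forall>g\<in>carrier G - F. d (\<phi> g x) (\<phi> g y) \<le> \<epsilon>))"

(* The supremum is taken in [0,\<infinity>), so that it is 0 for empty K (e.g. for K = B - A with A = B);
   the real-valued Sup is unspecified on the empty set.  Over a compact space the
   distances are bounded, so it is the true supremum otherwise. *)
definition dist_over ::
    "('x \<Rightarrow> 'x \<Rightarrow> real) \<Rightarrow> ('g \<Rightarrow> 'x \<Rightarrow> 'x) \<Rightarrow> 'g set \<Rightarrow> 'x \<Rightarrow> 'x \<Rightarrow> real" where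
  "dist_over d \<phi> K x y = (if K = {} then 0 else (SUP g\<in>K. d (\<phi> g x) (\<phi> g y)))"

definition memory_set ::
    "('g, 'm) monoid_scheme \<Rightarrow> 'x topology \<Rightarrow> ('x \<Rightarrow> 'x \<Rightarrow> real) \<Rightarrow> ('g \<Rightarrow> 'x \<Rightarrow> 'x)
     \<Rightarrow> real \<Rightarrow> real \<Rightarrow> 'g set \<Rightarrow> 'g set \<Rightarrow> bool" where
  "memory_set G X d \<phi> \<epsilon> \<delta> A B \<longleftrightarrow> finite B \<and> A \<subseteq> B \<and> B \<subseteq> carrier G \<and>
     (\<forall>x\<in>topspace X. \<forall>y\<in>topspace X. dist_over d \<phi> (B - A) x y \<le> \<delta> \<longrightarrow>
        (\<exists>z\<in>topspace X. dist_over d \<phi> B x z \<le> \<epsilon> \<and>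
           dist_over d \<phi> (carrier G - A) y z \<le> \<epsilon>))"

definition topological_Markov_property ::
    "('g, 'm) monoid_scheme \<Rightarrow> 'x topology \<Rightarrow> ('x \<Rightarrow> 'x \<Rightarrow> real) \<Rightarrow> ('g \<Rightarrow> 'x \<Rightarrow> 'x) \<Rightarrow> bool" where
  "topological_Markov_property G X d \<phi> \<longleftrightarrow>
     (\<forall>\<epsilon>>0. \<exists>\<delta>>0. \<forall>A. finite A \<and> A \<subseteq> carrier G \<longrightarrow> (\<exists>B. memory_set G X d \<phi> \<epsilon> \<delta> A B))"

end

theory Submission
  imports Defs
begin

text \<open>
  Without off-diagonal asymptotic pairs, compactness shows that orbits which stay close on a large
  finite set around \<open>A\<close> are already close on \<open>A\<close>, so one may glue with \<open>z = y\<close>.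

  Conversely, let \<open>(p, q)\<close> be an off-diagonal asymptotic pair. The Markov property allows one to swap
  \<open>p\<close> for \<open>q\<close> in a point \<open>z\<close> at any \<open>g\<close> with \<open>g z\<close> near \<open>p\<close>, and by expansivity the errors of swaps
  at sufficiently separated places do not accumulate. Swapping along the subsets of a set of \<open>k\<close>
  separated return times of \<open>p\<close> gives \<open>2^k\<close> points which are pairwise far apart on a set \<open>C\<close> of size
  \<open>k\<close>, while only \<open>O(k\<^sup>2)\<close> translates of \<open>p\<close> interact with the places of the swaps. Hence one of these
  points, \<open>p'\<close>, is not approximated on \<open>C\<close> by any interacting translate of \<open>p\<close>. Now swap \<open>p'\<close> for \<open>p\<close>
  in some point, again and again: a swap destroys the occurrence of \<open>p'\<close> at its place and creates none
  nearby, so that all places are automatically separated and none is used twice. By minimality some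
  occurrence of \<open>p'\<close> always remains within a fixed finite set of places, a contradiction.
\<close>

section \<open>Compactness, expansivity and minimality in finite form\<close>

locale compact_metric_action = group G + group_action G "topspace X" \<phi> + Metric_space "topspace X" d
  for G :: "('g, 'm) monoid_scheme" (structure)
    and X :: "'x topology" and \<phi> :: "'g \<Rightarrow> 'x \<Rightarrow> 'x" and d :: "'x \<Rightarrow> 'x \<Rightarrow> real" +
  assumes compact: "compact_space X"
    and mtopology_eq: "mtopology = X"
    and homeo: "g \<in> carrier G \<Longrightarrow> homeomorphic_map X X (\<phi> g)"
begin

lemma act_closed [simp]: "g \<in> carrier G \<Longrightarrow> x \<in> topspace X \<Longrightarrow> \<phi> g x \<in> topspace X"
  using element_image by blast

lemma act_one [simp]: "x \<in> topspace X \<Longrightarrow> \<phi> \<one> x = x"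
  by (metis id_eq_one restrict_apply')

lemma continuous_map_act: "g \<in> carrier G \<Longrightarrow> continuous_map X X (\<phi> g)"
  using homeo homeomorphic_imp_continuous_map by blast

lemma continuous_map_dist:
  assumes f: "continuous_map Y X f" and g: "continuous_map Y X g"
  shows "continuous_map Y euclideanreal (\<lambda>y. d (f y) (g y))"
proof -
  have "mtopology_of (metric (topspace X, d)) = X"
    by (metis mtopology_of mtopology_eq)
  then show ?thesis
    using continuous_map_mdist[of Y "metric (topspace X, d)" f g] f g by (simp add: mdist_metric)
qed

lemma continuous_map_dist_orbit:
  assumes "g \<in> carrier G"
  shows "continuous_map (prod_topology X X) euclideanreal (\<lambda>u. d (\<phi> g (fst u)) (\<phi> g (snd u)))"
proof -
  have "continuous_map (prod_topology X X) X (\<lambda>u. \<phi> g (fst u))"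
       "continuous_map (prod_topology X X) X (\<lambda>u. \<phi> g (snd u))"
    using continuous_map_compose[OF continuous_map_fst continuous_map_act[OF assms]]
      continuous_map_compose[OF continuous_map_snd continuous_map_act[OF assms]]
    by (simp_all add: comp_def)
  then show ?thesis by (rule continuous_map_dist)
qed

lemma dist_bounded: "\<exists>b. \<forall>x\<in>topspace X. \<forall>y\<in>topspace X. d x y \<le> b"
  using compactin_imp_mbounded[of "topspace X"] compact mtopology_eq
  by (auto simp: mbounded_alt compact_space_def)

lemma dist_over_le_iff:
  assumes "K \<subseteq> carrier G" "x \<in> topspace X" "y \<in> topspace X" "0 \<le> \<alpha>"
  shows "dist_over d \<phi> K x y \<le> \<alpha> \<longleftrightarrow> (\<forall>g\<in>K. d (\<phi> g x) (\<phi> g y) \<le> \<alpha>)"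
proof (cases "K = {}")
  case False
  obtain b where "\<forall>x\<in>topspace X. \<forall>y\<in>topspace X. d x y \<le> b"
    using dist_bounded by blast
  then have "bdd_above ((\<lambda>g. d (\<phi> g x) (\<phi> g y)) ` K)"
    using assms by (intro bdd_aboveI[of _ b]) auto
  then show ?thesis
    using False by (simp add: dist_over_def cSUP_le_iff)
qed (simp add: dist_over_def assms)

lemma memory_set_iff:
  assumes "0 \<le> \<epsilon>" "0 \<le> \<delta>"
  shows "memory_set G X d \<phi> \<epsilon> \<delta> A B \<longleftrightarrow> finite B \<and> A \<subseteq> B \<and> B \<subseteq> carrier G \<and>
    (\<forall>x\<in>topspace X. \<forall>y\<in>topspace X. (\<forall>g\<in>B - A. d (\<phi> g x) (\<phi> g y) \<le> \<delta>) \<longrightarrow>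
      (\<exists>z\<in>topspace X. (\<forall>g\<in>B. d (\<phi> g x) (\<phi> g z) \<le> \<epsilon>) \<and>
         (\<forall>g\<in>carrier G - A. d (\<phi> g y) (\<phi> g z) \<le> \<epsilon>)))"
proof (cases "B \<subseteq> carrier G")
  case True
  then have "B - A \<subseteq> carrier G" "carrier G - A \<subseteq> carrier G" by auto
  with True show ?thesis
    unfolding memory_set_def using assms by (simp add: dist_over_le_iff cong: bex_cong)
qed (simp add: memory_set_def)

text \<open>The pairs at distance above \<open>\<alpha>\<close> at some \<open>g\<close> in
  \<open>J\<close>, together with those at distance below \<open>\<beta>\<close> at
  \<open>t\<close>, cover the compact square of \<open>X\<close>; a finite subcover selects
  \<open>F\<close>. The strict inequalities make the covering sets open.\<close>

lemma finite_window:
  assumes J: "J \<subseteq> carrier G" and t: "t \<in> carrier G"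
    and imp: "\<forall>x\<in>topspace X. \<forall>y\<in>topspace X. (\<forall>g\<in>J. d (\<phi> g x) (\<phi> g y) \<le> \<alpha>) \<longrightarrow> d (\<phi> t x) (\<phi> t y) < \<beta>"
  shows "\<exists>F. finite F \<and> F \<subseteq> J \<and>
    (\<forall>x\<in>topspace X. \<forall>y\<in>topspace X. (\<forall>g\<in>F. d (\<phi> g x) (\<phi> g y) \<le> \<alpha>) \<longrightarrow> d (\<phi> t x) (\<phi> t y) < \<beta>)"
proof -
  let ?P = "prod_topology X X"
  define D where "D g u = d (\<phi> g (fst u)) (\<phi> g (snd u))" for g u
  define W where "W g = {u \<in> topspace ?P. D g u \<in> {\<alpha><..}}" for g
  define U where "U = {u \<in> topspace ?P. D t u \<in> {..<\<beta>}}"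
  have D: "continuous_map ?P euclideanreal (D g)" if "g \<in> carrier G" for g
    using continuous_map_dist_orbit[OF that] by (simp add: D_def[abs_def])
  have "openin ?P U" unfolding U_def
    by (rule openin_continuous_map_preimage[OF D[OF t]]) auto
  moreover have "openin ?P (W g)" if "g \<in> J" for g unfolding W_def
    by (rule openin_continuous_map_preimage[OF D]) (use that J in auto)
  moreover have "topspace ?P \<subseteq> \<Union>(insert U (W ` J))"
    using imp by (force simp: U_def W_def D_def)
  moreover have "compact_space ?P"
    using compact by (simp add: compact_space_prod_topology)
  ultimately have "\<exists>\<F>. finite \<F> \<and> \<F> \<subseteq> insert U (W ` J) \<and> topspace ?P \<subseteq> \<Union>\<F>"
    unfolding compact_space_def by (intro compactinD) auto
  then obtain \<F> where \<F>: "finite \<F>" "\<F> \<subseteq> insert U (W ` J)" "topspace ?P \<subseteq> \<Union>\<F>"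
    by (elim exE conjE)
  then have "finite (\<F> - {U})" "\<F> - {U} \<subseteq> W ` J" by auto
  then obtain F where F: "F \<subseteq> J" "finite F" "\<F> - {U} = W ` F"
    by (meson finite_subset_image)
  show ?thesis
  proof (intro exI[of _ F] conjI ballI impI F(1,2))
    fix x y
    assume xy: "x \<in> topspace X" "y \<in> topspace X" "\<forall>g\<in>F. d (\<phi> g x) (\<phi> g y) \<le> \<alpha>"
    then have "(x, y) \<notin> W g" if "g \<in> F" for g
      using that by (force simp: W_def D_def)
    moreover have "(x, y) \<in> \<Union>\<F>"
      using \<F>(3) xy by auto
    ultimately have "(x, y) \<in> U"
      using F(3) by blast
    then show "d (\<phi> t x) (\<phi> t y) < \<beta>"
      by (simp add: U_def D_def)
  qed
qed

definition expansivity_constant :: "real \<Rightarrow> bool" where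
  "expansivity_constant c \<longleftrightarrow>
     (\<forall>x\<in>topspace X. \<forall>y\<in>topspace X. (\<forall>g\<in>carrier G. d (\<phi> g x) (\<phi> g y) \<le> c) \<longrightarrow> x = y)"

lemma expansivity_constant_exists:
  assumes "expansive_action G X d \<phi>"
  obtains c where "0 < c" "expansivity_constant c"
  using assms unfolding expansive_action_def expansivity_constant_def by (meson not_less)

text \<open>Expansivity turns closeness along the whole group into equality, so
  \<open>finite_window\<close> applies. The unit is put into \<open>F\<close> to secure
  \<open>A \<subseteq> M \<subseteq> N\<close> later.\<close>

lemma uniform_expansivity:
  assumes c: "expansivity_constant c"
    and "0 < \<eta>"
  shows "\<exists>F. finite F \<and> F \<subseteq> carrier G \<and> \<one> \<in> F \<and>
    (\<forall>x\<in>topspace X. \<forall>y\<in>topspace X. (\<forall>f\<in>F. d (\<phi> f x) (\<phi> f y) \<le> c) \<longrightarrow> d x y \<le> \<eta>)"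
proof -
  have "d (\<phi> \<one> x) (\<phi> \<one> y) < \<eta>"
    if "x \<in> topspace X" "y \<in> topspace X" "\<forall>g\<in>carrier G. d (\<phi> g x) (\<phi> g y) \<le> c" for x y
  proof -
    have "x = y"
      using c that unfolding expansivity_constant_def by blast
    then show ?thesis
      using that \<open>0 < \<eta>\<close> by simp
  qed
  then have "\<exists>F. finite F \<and> F \<subseteq> carrier G \<and>
    (\<forall>x\<in>topspace X. \<forall>y\<in>topspace X. (\<forall>g\<in>F. d (\<phi> g x) (\<phi> g y) \<le> c) \<longrightarrow> d (\<phi> \<one> x) (\<phi> \<one> y) < \<eta>)"
    by (intro finite_window) simp_all
  then obtain F where F: "finite F" "F \<subseteq> carrier G" and
    le: "\<forall>x\<in>topspace X. \<forall>y\<in>topspace X. (\<forall>g\<in>F. d (\<phi> g x) (\<phi> g y) \<le> c) \<longrightarrow> d (\<phi> \<one> x) (\<phi> \<one> y) < \<eta>"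
    by (elim exE conjE)
  show ?thesis
  proof (intro exI[of _ "insert \<one> F"] conjI ballI impI)
    fix x y
    assume xy: "x \<in> topspace X" "y \<in> topspace X" and "\<forall>f\<in>insert \<one> F. d (\<phi> f x) (\<phi> f y) \<le> c"
    then have "d (\<phi> \<one> x) (\<phi> \<one> y) < \<eta>" using le by simp
    then show "d x y \<le> \<eta>" using xy by simp
  qed (use F in auto)
qed

text \<open>The points whose orbits never enter the given neighbourhood of \<open>p\<close> form a
  closed invariant set that misses \<open>p\<close>, so by minimality there are none. Compactness
  then leaves finitely many return times.\<close>

lemma syndetic_returns:
  assumes min: "minimal_action G X \<phi>" and p: "p \<in> topspace X"
    and V: "finite V" "V \<subseteq> carrier G" and "0 < \<eta>"
  shows "\<exists>K. finite K \<and> K \<subseteq> carrier G \<and>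
    (\<forall>z\<in>topspace X. \<exists>g\<in>K. \<forall>h\<in>V. d (\<phi> h (\<phi> g z)) (\<phi> h p) \<le> \<eta>)"
proof -
  define U where "U h = {z \<in> topspace X. d (\<phi> h z) (\<phi> h p) \<in> {..<\<eta>}}" for h
  \<comment> \<open>The factor \<open>topspace X\<close> matters for empty \<open>V\<close>, where
    the inner intersection is the whole type.\<close>
  define W where "W g = {z \<in> topspace X. \<phi> g z \<in> topspace X \<inter> (\<Inter>h\<in>V. U h)}" for g
  have "openin X (U h)" if "h \<in> V" for h
  proof -
    have h: "h \<in> carrier G" using that V by blast
    then have "continuous_map X X (\<lambda>z. \<phi> h p)" using p by simp
    then have "continuous_map X euclideanreal (\<lambda>z. d (\<phi> h z) (\<phi> h p))"
      using continuous_map_dist continuous_map_act[OF h] by blast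
    then show ?thesis
      unfolding U_def by (rule openin_continuous_map_preimage) auto
  qed
  then have "openin X (topspace X \<inter> (\<Inter>h\<in>V. U h))"
    using V by (cases "V = {}") (auto intro!: openin_Int openin_Inter)
  then have W: "openin X (W g)" if "g \<in> carrier G" for g
    unfolding W_def using openin_continuous_map_preimage[OF continuous_map_act[OF that]] by blast
  define Z where "Z = topspace X - (\<Union>g\<in>carrier G. W g)"
  have "closedin X Z"
    unfolding Z_def using W by blast
  moreover have "\<phi> g ` Z \<subseteq> Z" if g: "g \<in> carrier G" for g
  proof
    fix z assume "z \<in> \<phi> g ` Z"
    then obtain y where y: "y \<in> Z" "z = \<phi> g y" by blast
    then have yX: "y \<in> topspace X" by (simp add: Z_def)
    have "z \<notin> W h" if "h \<in> carrier G" for h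
    proof
      assume "z \<in> W h"
      then have "y \<in> W (h \<otimes> g)"
        using y yX that g by (simp add: W_def composition_rule)
      with y that g show False by (auto simp: Z_def)
    qed
    then show "z \<in> Z" using y yX g by (auto simp: Z_def)
  qed
  moreover have "p \<in> W \<one>"
    using p V \<open>0 < \<eta>\<close> by (auto simp: W_def U_def)
  then have "p \<notin> Z" by (auto simp: Z_def)
  ultimately have "Z = {}"
    using min p unfolding minimal_action_def by blast
  then have "topspace X \<subseteq> \<Union>(W ` carrier G)" by (auto simp: Z_def)
  then have "\<exists>\<F>. finite \<F> \<and> \<F> \<subseteq> W ` carrier G \<and> topspace X \<subseteq> \<Union>\<F>"
    using compact W unfolding compact_space_def by (intro compactinD) auto
  then obtain \<F> where "finite \<F>" "\<F> \<subseteq> W ` carrier G" "topspace X \<subseteq> \<Union>\<F>"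
    by (elim exE conjE)
  then obtain K where K: "K \<subseteq> carrier G" "finite K" "topspace X \<subseteq> \<Union>(W ` K)"
    by (metis finite_subset_image)
  show ?thesis
  proof (intro exI[of _ K] conjI ballI K(1,2))
    fix z assume "z \<in> topspace X"
    then obtain g where "g \<in> K" "z \<in> W g" using K by blast
    then show "\<exists>g\<in>K. \<forall>h\<in>V. d (\<phi> h (\<phi> g z)) (\<phi> h p) \<le> \<eta>"
      by (force simp: W_def U_def)
  qed
qed


text \<open>Closeness up to \<open>c\<close> on \<open>F g\<close> gives closeness up to
  \<open>\<eta>\<close> at \<open>g\<close>, and \<open>F g\<close> meets \<open>A\<close> only for
  the finitely many \<open>g\<close> of the form \<open>inv f \<otimes> a\<close>.\<close>

lemma asymptotic_pairI:
  assumes c: "expansivity_constant c"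
    and A: "finite A" "A \<subseteq> carrier G" and xy: "x \<in> topspace X" "y \<in> topspace X"
    and le: "\<And>g. g \<in> carrier G - A \<Longrightarrow> d (\<phi> g x) (\<phi> g y) \<le> c"
  shows "asymptotic_pair G X d \<phi> x y"
  unfolding asymptotic_pair_def
proof (intro conjI allI impI xy)
  fix \<eta> :: real assume "0 < \<eta>"
  obtain F where F: "finite F" "F \<subseteq> carrier G"
    and small: "\<forall>x\<in>topspace X. \<forall>y\<in>topspace X. (\<forall>f\<in>F. d (\<phi> f x) (\<phi> f y) \<le> c) \<longrightarrow> d x y \<le> \<eta>"
    using uniform_expansivity[OF c \<open>0 < \<eta>\<close>] by (elim exE conjE)
  let ?E = "(\<lambda>(f, a). inv f \<otimes> a) ` (F \<times> A)"
  have "d (\<phi> g x) (\<phi> g y) \<le> \<eta>" if g: "g \<in> carrier G - ?E" for g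
  proof -
    have "d (\<phi> f (\<phi> g x)) (\<phi> f (\<phi> g y)) \<le> c" if f: "f \<in> F" for f
    proof -
      have "f \<otimes> g \<notin> A"
      proof
        assume "f \<otimes> g \<in> A"
        moreover have "g = inv f \<otimes> (f \<otimes> g)"
          using f F(2) g by (simp add: m_assoc[symmetric] subset_iff)
        ultimately have "g \<in> ?E" using f by force
        with g show False by blast
      qed
      moreover have "f \<in> carrier G" using f F(2) by blast
      ultimately show ?thesis
        using le[of "f \<otimes> g"] g xy by (simp add: composition_rule[symmetric])
    qed
    then show ?thesis using small g xy by simp
  qed
  moreover have "finite ?E" "?E \<subseteq> carrier G"
    using F A by auto
  ultimately show "\<exists>F. finite F \<and> F \<subseteq> carrier G \<and> (\<forall>g\<in>carrier G - F. d (\<phi> g x) (\<phi> g y) \<le> \<eta>)"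
    by blast
qed

section \<open>From the absence of asymptotic pairs to the Markov property\<close>

theorem topological_Markov_property_if_no_asymptotic_pairs:
  assumes exp: "expansive_action G X d \<phi>"
    and no_pairs: "\<And>x y. asymptotic_pair G X d \<phi> x y \<Longrightarrow> x = y"
  shows "topological_Markov_property G X d \<phi>"
proof -
  obtain c where "0 < c" and c: "expansivity_constant c"
    using exp expansivity_constant_exists by blast
  \<comment> \<open>\<open>c\<close> serves \<open>finite_window\<close>, and
    \<open>\<epsilon>\<close> bounds the error on \<open>B - A\<close> directly. The choice is
    uniform in \<open>A\<close>.\<close>
  have "\<exists>B. memory_set G X d \<phi> \<epsilon> (min c \<epsilon>) A B"
    if "0 < \<epsilon>" and A: "finite A" "A \<subseteq> carrier G" for \<epsilon> A
  proof -
    \<comment> \<open>Pairs that are \<open>c\<close>-close off \<open>A\<close> are asymptotic,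
      hence equal; so finitely many positions outside \<open>A\<close> already force closeness at
      \<open>a\<close>.\<close>
    have "\<exists>F. finite F \<and> F \<subseteq> carrier G - A \<and>
        (\<forall>x\<in>topspace X. \<forall>y\<in>topspace X. (\<forall>g\<in>F. d (\<phi> g x) (\<phi> g y) \<le> c) \<longrightarrow> d (\<phi> a x) (\<phi> a y) < \<epsilon>)"
      if "a \<in> A" for a
    proof -
      have "d (\<phi> a x) (\<phi> a y) < \<epsilon>"
        if "x \<in> topspace X" "y \<in> topspace X" "\<forall>g\<in>carrier G - A. d (\<phi> g x) (\<phi> g y) \<le> c" for x y
      proof -
        have "asymptotic_pair G X d \<phi> x y"
          by (rule asymptotic_pairI[OF c A]) (use that in auto)
        then have "x = y" by (rule no_pairs)
        then show ?thesis
          using that \<open>a \<in> A\<close> A \<open>0 < \<epsilon>\<close> by (simp add: subset_iff)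
      qed
      then show ?thesis
        using \<open>a \<in> A\<close> A by (intro finite_window) auto
    qed
    then obtain F where F: "\<And>a. a \<in> A \<Longrightarrow> finite (F a)" "\<And>a. a \<in> A \<Longrightarrow> F a \<subseteq> carrier G - A"
      "\<And>a x y. \<lbrakk>a \<in> A; x \<in> topspace X; y \<in> topspace X; \<forall>g\<in>F a. d (\<phi> g x) (\<phi> g y) \<le> c\<rbrakk> \<Longrightarrow> d (\<phi> a x) (\<phi> a y) < \<epsilon>"
      by metis
    let ?B = "A \<union> (\<Union>a\<in>A. F a)"
    have "memory_set G X d \<phi> \<epsilon> (min c \<epsilon>) A ?B"
    proof (subst memory_set_iff)
      show "finite ?B \<and> A \<subseteq> ?B \<and> ?B \<subseteq> carrier G \<and>
        (\<forall>x\<in>topspace X. \<forall>y\<in>topspace X. (\<forall>g\<in>?B - A. d (\<phi> g x) (\<phi> g y) \<le> min c \<epsilon>) \<longrightarrow>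
          (\<exists>z\<in>topspace X. (\<forall>g\<in>?B. d (\<phi> g x) (\<phi> g z) \<le> \<epsilon>) \<and>
            (\<forall>g\<in>carrier G - A. d (\<phi> g y) (\<phi> g z) \<le> \<epsilon>)))"
      proof (intro conjI ballI impI)
        fix x y
        assume xy: "x \<in> topspace X" "y \<in> topspace X"
          and le: "\<forall>g\<in>?B - A. d (\<phi> g x) (\<phi> g y) \<le> min c \<epsilon>"
        have "d (\<phi> g x) (\<phi> g y) \<le> \<epsilon>" if "g \<in> ?B" for g
        proof (cases "g \<in> A")
          case True
          then have "\<forall>h\<in>F g. d (\<phi> h x) (\<phi> h y) \<le> c"
            using le F(2) by fastforce
          then show ?thesis using F(3)[OF True xy] by simp
        qed (use le that in auto)
        then show "\<exists>z\<in>topspace X. (\<forall>g\<in>?B. d (\<phi> g x) (\<phi> g z) \<le> \<epsilon>) \<and>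
            (\<forall>g\<in>carrier G - A. d (\<phi> g y) (\<phi> g z) \<le> \<epsilon>)"
          using xy \<open>0 < \<epsilon>\<close> by (intro bexI[of _ y]) auto
      qed (use F A in auto)
    qed (use \<open>0 < c\<close> \<open>0 < \<epsilon>\<close> in auto)
    then show ?thesis ..
  qed
  moreover have "0 < min c \<epsilon>" if "0 < \<epsilon>" for \<epsilon>
    using that \<open>0 < c\<close> by simp
  ultimately show ?thesis
    unfolding topological_Markov_property_def by meson
qed

section \<open>Intersections of translates of finite sets\<close>

definition quot :: "'g set \<Rightarrow> 'g set \<Rightarrow> 'g set" where
  "quot S T = (\<lambda>(s, t). inv s \<otimes> t) ` (S \<times> T)"

lemma finite_quot: "finite S \<Longrightarrow> finite T \<Longrightarrow> finite (quot S T)"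
  by (simp add: quot_def)

lemma quot_subset: "S \<subseteq> carrier G \<Longrightarrow> T \<subseteq> carrier G \<Longrightarrow> quot S T \<subseteq> carrier G"
  by (auto simp: quot_def)

lemma quotI: "\<lbrakk>s \<otimes> g \<in> T; s \<in> S; s \<in> carrier G; g \<in> carrier G\<rbrakk> \<Longrightarrow> g \<in> quot S T"
  by (force simp: quot_def m_assoc[symmetric])

text \<open>Here \<open>h\<close> is a common element of \<open>S g\<close> and \<open>T g'\<close>.
  The contrapositive turns separation of places into disjointness of translates.\<close>

lemma quot_right_translates:
  assumes "h \<otimes> inv g \<in> S" "h \<otimes> inv g' \<in> T" "g \<in> carrier G" "g' \<in> carrier G" "h \<in> carrier G"
  shows "g \<otimes> inv g' \<in> quot S T"
proof (rule quotI)
  show "(h \<otimes> inv g) \<otimes> (g \<otimes> inv g') \<in> T"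
    using assms by (simp add: m_assoc) (simp add: m_assoc[symmetric])
qed (use assms in auto)

lemma card_quot_le:
  assumes "finite S" "finite T"
  shows "card (quot S T) \<le> card S * card T"
  unfolding quot_def using card_image_le[of "S \<times> T"] assms by (simp add: card_cartesian_product)

lemma set_mult_eq_image: "S <#> T = (\<lambda>(s, t). s \<otimes> t) ` (S \<times> T)"
  by (auto simp: set_mult_def)

lemma finite_set_mult: "finite S \<Longrightarrow> finite T \<Longrightarrow> finite (S <#> T)"
  by (simp add: set_mult_eq_image)

lemma card_set_mult_le:
  assumes "finite S" "finite T"
  shows "card (S <#> T) \<le> card S * card T"
  unfolding set_mult_eq_image using card_image_le[of "S \<times> T"] assms by (simp add: card_cartesian_product)

text \<open>For fixed \<open>F\<close> the bound is quadratic in \<open>card A\<close>; this growth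
  is what an exponential number of swapped points will beat.\<close>

lemma card_exclusion_le:
  assumes F: "finite F" and A: "finite A"
  defines "M \<equiv> quot F A"
  defines "N \<equiv> F <#> M"
  shows "card (quot N M \<union> quot M N) \<le> 2 * (card F ^ 3 * card A ^ 2)"
proof -
  have fin: "finite M" "finite N"
    unfolding M_def N_def using F A by (simp_all add: finite_quot finite_set_mult)
  have M: "card M \<le> card F * card A"
    unfolding M_def by (rule card_quot_le[OF F A])
  have N: "card N \<le> card F * card M"
    unfolding N_def by (rule card_set_mult_le[OF F fin(1)])
  have "card N * card M \<le> (card F * (card F * card A)) * (card F * card A)"
    by (intro mult_le_mono M order_trans[OF N] order_refl)
  moreover have "(card F * (card F * card A)) * (card F * card A) = card F ^ 3 * card A ^ 2"
    by (simp add: power2_eq_square power3_eq_cube)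
  moreover have "card (quot N M) \<le> card N * card M" "card (quot M N) \<le> card N * card M"
    using card_quot_le[OF fin(2,1)] card_quot_le[OF fin] by (simp_all add: mult.commute)
  ultimately show ?thesis
    using card_Un_le[of "quot N M" "quot M N"] by linarith
qed

end

section \<open>Swapping asymptotic points\<close>

text \<open>
  A swap at \<open>g\<close> replaces \<open>p\<close> by \<open>q\<close> at the place \<open>g\<close> of the orbit of a point, and affects it at the \<open>h\<close>
  with \<open>h g\<^sup>-\<^sup>1 \<in> A\<close>. Membership of \<open>h\<close> in a translate \<open>S g\<close> is always expressed as \<open>h \<otimes> inv g \<in> S\<close>.
\<close>

locale swap_step = compact_metric_action G X \<phi> d
  for G :: "('g, 'm) monoid_scheme" (structure)
    and X :: "'x topology" and \<phi> :: "'g \<Rightarrow> 'x \<Rightarrow> 'x" and d :: "'x \<Rightarrow> 'x \<Rightarrow> real" +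
  fixes c \<epsilon> \<kappa> :: real and F A B :: "'g set" and p q w :: 'x
  assumes \<kappa>: "0 < \<kappa>" and \<epsilon>: "0 < \<epsilon>" "\<epsilon> + 5 * \<kappa> \<le> c"
    and F: "finite F" "F \<subseteq> carrier G" "\<one> \<in> F"
    and window: "\<And>x y. \<lbrakk>x \<in> topspace X; y \<in> topspace X; \<And>f. f \<in> F \<Longrightarrow> d (\<phi> f x) (\<phi> f y) \<le> c\<rbrakk> \<Longrightarrow> d x y \<le> \<kappa>"
    and A: "finite A" "A \<subseteq> carrier G"
    and p: "p \<in> topspace X" and q: "q \<in> topspace X" and w: "w \<in> topspace X"
    and pq: "\<And>h. h \<in> carrier G \<Longrightarrow> h \<notin> A \<Longrightarrow> d (\<phi> h p) (\<phi> h q) \<le> \<kappa>"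
    and mem: "memory_set G X d \<phi> \<epsilon> (3 * \<kappa>) A B"
begin

text \<open>Relative to a swap, \<open>M\<close> holds the positions whose \<open>F\<close>-window
  meets \<open>A\<close>, so a comparison over any other window does not see the swap.
  \<open>N\<close> collects what the windows of positions in \<open>M\<close> see.\<close>

definition M where "M = quot F A"
definition N where "N = F <#> M"

lemma M: "finite M" "M \<subseteq> carrier G"
  using finite_quot quot_subset F A by (auto simp: M_def)

lemma N: "finite N" "N \<subseteq> carrier G"
proof -
  show "finite N" unfolding N_def using F M by (simp add: finite_set_mult)
  show "N \<subseteq> carrier G" unfolding N_def using F M set_mult_closed by blast
qed

lemma M_I: "\<lbrakk>f \<in> F; g \<in> carrier G; f \<otimes> g \<in> A\<rbrakk> \<Longrightarrow> g \<in> M"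
  unfolding M_def using F by (auto intro: quotI)

lemma N_I: "\<lbrakk>f \<in> F; g \<in> M\<rbrakk> \<Longrightarrow> f \<otimes> g \<in> N"
  by (auto simp: N_def set_mult_def)

lemma A_subset_M: "A \<subseteq> M"
  using M_I[of \<one>] F A by auto

lemma M_subset_N: "M \<subseteq> N"
  using N_I[of \<one>] F M by fastforce

text \<open>
  The labelling \<open>l\<close> is the exact combinatorial record of swaps of \<open>w\<close> at the places in \<open>P\<close>, and \<open>z\<close> is a
  point realizing it. Labels far from a new swap do not change at all, in contrast to \<open>z\<close>.
\<close>

definition tracks :: "'g set \<Rightarrow> ('g \<Rightarrow> 'x) \<Rightarrow> 'x \<Rightarrow> bool" where
  "tracks P l z \<longleftrightarrow> z \<in> topspace X \<and> P \<subseteq> carrier G \<and>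
     (\<forall>h\<in>carrier G. l h \<in> topspace X \<and> d (\<phi> h z) (l h) \<le> \<kappa> \<and>
       ((\<forall>g\<in>P. h \<otimes> inv g \<notin> M) \<longrightarrow> l h = \<phi> h w) \<and>
       (\<forall>g\<in>P. (h \<otimes> inv g \<in> M \<longrightarrow> l h = \<phi> (h \<otimes> inv g) q) \<and>
          (h \<otimes> inv g \<in> N \<longrightarrow> d (\<phi> h w) (\<phi> (h \<otimes> inv g) p) \<le> 3 * \<kappa> \<and>
             (\<forall>g'\<in>P. h \<otimes> inv g' \<in> M \<longrightarrow> g' = g))))"

text \<open>The label is overwritten on \<open>M\<close> rather than on \<open>A\<close>, because
  the old label is certain to survive only at positions whose window misses
  \<open>A\<close>.\<close>

definition relabel :: "'g \<Rightarrow> ('g \<Rightarrow> 'x) \<Rightarrow> 'g \<Rightarrow> 'x" where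
  "relabel g l h = (if h \<otimes> inv g \<in> M then \<phi> (h \<otimes> inv g) q else l h)"

lemma tracks_empty: "tracks {} (\<lambda>h. \<phi> h w) w"
  using w \<kappa> by (simp add: tracks_def)

text \<open>The memory set glues \<open>q\<close> on \<open>B\<close> to \<open>\<phi> g z\<close>
  off \<open>A\<close>, and \<open>inv g\<close> carries the result back to the place
  \<open>g\<close>. The accuracy is only \<open>\<epsilon>\<close>.\<close>

lemma swap:
  assumes z: "z \<in> topspace X" and g: "g \<in> carrier G"
    and near: "\<And>h. h \<in> B \<Longrightarrow> d (\<phi> h (\<phi> g z)) (\<phi> h p) \<le> 2 * \<kappa>"
  shows "\<exists>z'\<in>topspace X. \<forall>h\<in>carrier G.
    d (\<phi> h z') (if h \<otimes> inv g \<in> A then \<phi> (h \<otimes> inv g) q else \<phi> h z) \<le> \<epsilon>"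
proof -
  have mem': "B \<subseteq> carrier G" "A \<subseteq> B" "\<And>x y. \<lbrakk>x\<in>topspace X; y\<in>topspace X; \<forall>h\<in>B - A. d (\<phi> h x) (\<phi> h y) \<le> 3 * \<kappa>\<rbrakk> \<Longrightarrow>
      (\<exists>z\<in>topspace X. (\<forall>h\<in>B. d (\<phi> h x) (\<phi> h z) \<le> \<epsilon>) \<and>
         (\<forall>h\<in>carrier G - A. d (\<phi> h y) (\<phi> h z) \<le> \<epsilon>))"
    using mem memory_set_iff[of \<epsilon> "3 * \<kappa>" A B] \<epsilon> \<kappa> by auto
  \<comment> \<open>The errors \<open>\<kappa>\<close> from \<open>pq\<close> and
    \<open>2 * \<kappa>\<close> from \<open>near\<close> add up to the tolerance of the memory
    set.\<close>
  have "d (\<phi> h q) (\<phi> h (\<phi> g z)) \<le> 3 * \<kappa>" if "h \<in> B - A" for h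
  proof -
    have h: "h \<in> carrier G" using that mem' by blast
    then have "d (\<phi> h q) (\<phi> h (\<phi> g z)) \<le> d (\<phi> h q) (\<phi> h p) + d (\<phi> h p) (\<phi> h (\<phi> g z))"
      using triangle p q g z by simp
    then show ?thesis
      using near[of h] pq[OF h] that by (simp add: commute)
  qed
  then obtain v where v: "v \<in> topspace X" "\<forall>h\<in>B. d (\<phi> h q) (\<phi> h v) \<le> \<epsilon>"
      "\<forall>h\<in>carrier G - A. d (\<phi> h (\<phi> g z)) (\<phi> h v) \<le> \<epsilon>"
    using mem'(3)[of q "\<phi> g z"] q z g by auto
  show ?thesis
  proof (intro bexI[of _ "\<phi> (inv g) v"] ballI)
    fix h assume h: "h \<in> carrier G"
    have *: "\<phi> h (\<phi> (inv g) v) = \<phi> (h \<otimes> inv g) v"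
      using h g v by (simp add: composition_rule)
    have **: "\<phi> (h \<otimes> inv g) (\<phi> g z) = \<phi> h z"
      using h g z by (simp add: composition_rule[symmetric] m_assoc)
    have hg: "h \<otimes> inv g \<in> carrier G" using h g by simp
    have "d (\<phi> (h \<otimes> inv g) v) (\<phi> (h \<otimes> inv g) q) \<le> \<epsilon>" if "h \<otimes> inv g \<in> A"
      using that v(2) mem'(2) by (simp add: commute subset_iff)
    moreover have "d (\<phi> (h \<otimes> inv g) v) (\<phi> h z) \<le> \<epsilon>" if "h \<otimes> inv g \<notin> A"
      using that v(3) hg by (simp add: ** [symmetric] commute)
    ultimately show "d (\<phi> h (\<phi> (inv g) v)) (if h \<otimes> inv g \<in> A then \<phi> (h \<otimes> inv g) q else \<phi> h z) \<le> \<epsilon>"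
      using * by simp
  qed (use g v in auto)
qed

lemma dist_through: "\<lbrakk>d x y \<le> \<alpha>; d y z \<le> \<beta>; x \<in> topspace X; y \<in> topspace X; z \<in> topspace X\<rbrakk> \<Longrightarrow> d x z \<le> \<alpha> + \<beta>"
  using triangle[of x y z] by simp

lemma tracksD:
  assumes "tracks P l z"
  shows "z \<in> topspace X" "P \<subseteq> carrier G"
    and "\<And>h. h \<in> carrier G \<Longrightarrow> l h \<in> topspace X"
    and "\<And>h. h \<in> carrier G \<Longrightarrow> d (\<phi> h z) (l h) \<le> \<kappa>"
    and "\<And>h. \<lbrakk>h \<in> carrier G; \<And>g. g \<in> P \<Longrightarrow> h \<otimes> inv g \<notin> M\<rbrakk> \<Longrightarrow> l h = \<phi> h w"
    and "\<And>h g. \<lbrakk>h \<in> carrier G; g \<in> P; h \<otimes> inv g \<in> M\<rbrakk> \<Longrightarrow> l h = \<phi> (h \<otimes> inv g) q"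
    and "\<And>h g. \<lbrakk>h \<in> carrier G; g \<in> P; h \<otimes> inv g \<in> N\<rbrakk> \<Longrightarrow> d (\<phi> h w) (\<phi> (h \<otimes> inv g) p) \<le> 3 * \<kappa>"
    and "\<And>h g g'. \<lbrakk>h \<in> carrier G; g \<in> P; g' \<in> P; h \<otimes> inv g \<in> N; h \<otimes> inv g' \<in> M\<rbrakk> \<Longrightarrow> g' = g"
  using assms unfolding tracks_def by blast+

lemma dist_w_q:
  assumes "tracks P l z" "k \<in> carrier G" "g \<in> P" "k \<otimes> inv g \<in> N" "k \<otimes> inv g \<notin> A"
  shows "d (\<phi> k w) (\<phi> (k \<otimes> inv g) q) \<le> 4 * \<kappa>"
proof -
  have "k \<otimes> inv g \<in> carrier G" using assms(4) N by blast
  then have "d (\<phi> k w) (\<phi> (k \<otimes> inv g) q) \<le> 3 * \<kappa> + \<kappa>"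
    using dist_through[OF tracksD(7)[OF assms(1-4)] pq[OF _ assms(5)]] w p q assms(2) by simp
  then show ?thesis by simp
qed

text \<open>
  Consistency of the labels makes expansivity improve a realization up to \<open>\<epsilon> + \<kappa>\<close> to one up to \<open>\<kappa>\<close>,
  which is why errors do not accumulate in \<open>tracks_insert\<close>.
\<close>

lemma tracks_consistent:
  assumes tr: "tracks P l z" and h: "h \<in> carrier G" and f: "f \<in> F"
  shows "d (l (f \<otimes> h)) (\<phi> f (l h)) \<le> 4 * \<kappa>"
proof -
  define k where "k = f \<otimes> h"
  have fG: "f \<in> carrier G" using f F by blast
  have k: "k \<in> carrier G" using fG h by (simp add: k_def)
  have k_inv: "k \<otimes> inv g = f \<otimes> (h \<otimes> inv g)" if "g \<in> P" for g
    using that fG h tracksD(2)[OF tr] by (auto simp: k_def m_assoc)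
  have lk: "l k \<in> topspace X" using tracksD(3)[OF tr k] .
  have "d (l k) (\<phi> f (l h)) \<le> 4 * \<kappa>"
  proof (cases "\<exists>g\<in>P. h \<otimes> inv g \<in> M")
    case True
    then obtain g where g: "g \<in> P" "h \<otimes> inv g \<in> M" by blast
    then have gG: "g \<in> carrier G" using tracksD(2)[OF tr] by blast
    have kN: "k \<otimes> inv g \<in> N" using N_I[OF f g(2)] k_inv[OF g(1)] by simp
    have lh: "\<phi> f (l h) = \<phi> (k \<otimes> inv g) q"
      using tracksD(6)[OF tr h g] k_inv[OF g(1)] fG h gG q by (simp add: composition_rule)
    show ?thesis
    proof (cases "k \<otimes> inv g \<in> M")
      case True
      then show ?thesis using tracksD(6)[OF tr k g(1)] lh lk \<kappa> by simp
    next
      case False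
      \<comment> \<open>As \<open>k\<close> lies in the \<open>N\<close>-translate of
        \<open>g\<close>, the uniqueness clause keeps it out of the \<open>M\<close>-translates of
        all other places.\<close>
      have "l k = \<phi> k w"
        using tracksD(5)[OF tr k] tracksD(8)[OF tr k g(1) _ kN] False by blast
      moreover have "k \<otimes> inv g \<notin> A" using False A_subset_M by blast
      ultimately show ?thesis using dist_w_q[OF tr k g(1) kN] lh by simp
    qed
  next
    case False
    then have "l h = \<phi> h w" using tracksD(5)[OF tr h] by blast
    then have lh: "\<phi> f (l h) = \<phi> k w" using fG h w by (simp add: k_def composition_rule)
    show ?thesis
    proof (cases "\<exists>g\<in>P. k \<otimes> inv g \<in> M")
      case True
      then obtain g where g: "g \<in> P" "k \<otimes> inv g \<in> M" by blast
      have gG: "g \<in> carrier G" using g tracksD(2)[OF tr] by blast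
      \<comment> \<open>Otherwise the window of \<open>h\<close> would meet the
        \<open>A\<close>-translate of \<open>g\<close>. Off \<open>A\<close>, \<open>q\<close> can
        be traded for \<open>p\<close>, which \<open>w\<close> shadows there.\<close>
      have "k \<otimes> inv g \<notin> A"
        using False g(1) M_I[OF f, of "h \<otimes> inv g"] k_inv[OF g(1)] h gG by auto
      then have "d (\<phi> k w) (\<phi> (k \<otimes> inv g) q) \<le> 4 * \<kappa>"
        using dist_w_q[OF tr k g(1)] g(2) M_subset_N by blast
      then show ?thesis
        using tracksD(6)[OF tr k g] lh by (simp add: commute)
    next
      case False
      then have "l k = \<phi> k w" using tracksD(5)[OF tr k] by blast
      then show ?thesis using lh lk \<kappa> by simp
    qed
  qed
  then show ?thesis by (simp add: k_def)
qed

text \<open>The coarse \<open>\<epsilon>\<close>-estimate is kept beside the refined realization: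
  labels record \<open>q\<close> only on \<open>M\<close>, while
  \<open>recurrence_not_excluded\<close> needs the new point near \<open>q\<close> at other
  positions too.\<close>

lemma tracks_insert:
  assumes tr: "tracks P l z" and g: "g \<in> carrier G"
    and near: "\<And>h. h \<in> B \<union> N \<Longrightarrow> d (\<phi> h (\<phi> g z)) (\<phi> h p) \<le> 2 * \<kappa>"
    and sep: "\<And>g'. g' \<in> P \<Longrightarrow> g \<otimes> inv g' \<notin> quot N M \<union> quot M N"
  shows "\<exists>z'. tracks (insert g P) (relabel g l) z' \<and>
    (\<forall>h\<in>carrier G. d (\<phi> h z') (if h \<otimes> inv g \<in> A then \<phi> (h \<otimes> inv g) q else \<phi> h z) \<le> \<epsilon>)"
proof -
  note P = tracksD(2)[OF tr]
  note z = tracksD(1)[OF tr]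
  have "\<exists>z'\<in>topspace X. \<forall>h\<in>carrier G.
    d (\<phi> h z') (if h \<otimes> inv g \<in> A then \<phi> (h \<otimes> inv g) q else \<phi> h z) \<le> \<epsilon>"
    by (rule swap[OF z g]) (simp add: near)
  then obtain z' where z': "z' \<in> topspace X" and
    swapped: "\<forall>h\<in>carrier G. d (\<phi> h z') (if h \<otimes> inv g \<in> A then \<phi> (h \<otimes> inv g) q else \<phi> h z) \<le> \<epsilon>"
    by (elim bexE)
  have zA: "d (\<phi> h z') (\<phi> (h \<otimes> inv g) q) \<le> \<epsilon>" if "h \<in> carrier G" "h \<otimes> inv g \<in> A" for h
    using swapped[rule_format, OF that(1)] that(2) by simp
  have znA: "d (\<phi> h z') (\<phi> h z) \<le> \<epsilon>" if "h \<in> carrier G" "h \<otimes> inv g \<notin> A" for h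
    using swapped[rule_format, OF that(1)] that(2) by simp
  \<comment> \<open>The two halves of \<open>sep\<close> make \<open>N g\<close> disjoint from
    \<open>M g'\<close>, and \<open>M g\<close> from \<open>N g'\<close>, for every old place
    \<open>g'\<close>.\<close>
  have sep1: "h \<otimes> inv g' \<notin> M" if "h \<in> carrier G" "g' \<in> P" "h \<otimes> inv g \<in> N" for h g'
    using quot_right_translates[OF that(3) _ g _ that(1)] sep[OF that(2)] P that(2) by blast
  have sep2: "h \<otimes> inv g' \<notin> N" if "h \<in> carrier G" "g' \<in> P" "h \<otimes> inv g \<in> M" for h g'
    using quot_right_translates[OF that(3) _ g _ that(1)] sep[OF that(2)] P that(2) by blast
  have near': "d (\<phi> h z) (\<phi> (h \<otimes> inv g) p) \<le> 2 * \<kappa>" if "h \<in> carrier G" "h \<otimes> inv g \<in> N" for h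
    using near[of "h \<otimes> inv g"] that g z by (simp add: composition_rule[symmetric] m_assoc)
  have rl: "relabel g l h \<in> topspace X" if "h \<in> carrier G" for h
    using that g q tracksD(3)[OF tr] by (simp add: relabel_def)
  \<comment> \<open>An error of at most \<open>c\<close> on the window of \<open>h\<close> suffices,
    since expansivity returns \<open>\<kappa>\<close>. For \<open>h\<close> in the
    \<open>M\<close>-translate the cost is at most \<open>\<epsilon> + 3 * \<kappa>\<close>;
    elsewhere the route through the old label and \<open>tracks_consistent\<close> costs
    \<open>\<epsilon> + 5 * \<kappa>\<close>.\<close>
  have m1: "d (\<phi> h z') (relabel g l h) \<le> \<kappa>" if h: "h \<in> carrier G" for h
  proof (rule window)
    fix f assume f: "f \<in> F"
    define k where "k = f \<otimes> h"
    have fG: "f \<in> carrier G" using f F by blast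
    have k: "k \<in> carrier G" using fG h by (simp add: k_def)
    have k_inv: "k \<otimes> inv g = f \<otimes> (h \<otimes> inv g)"
      using fG h g by (simp add: k_def m_assoc)
    have "d (\<phi> k z') (\<phi> f (relabel g l h)) \<le> c"
    proof (cases "h \<otimes> inv g \<in> M")
      case True
      then have kN: "k \<otimes> inv g \<in> N" using N_I[OF f] k_inv by simp
      have r: "\<phi> f (relabel g l h) = \<phi> (k \<otimes> inv g) q"
        using True k_inv fG h g q by (simp add: relabel_def composition_rule)
      show ?thesis
      proof (cases "k \<otimes> inv g \<in> A")
        case True
        then show ?thesis using zA[OF k True] r \<epsilon> \<kappa> by simp
      next
        case False
        have 1: "d (\<phi> k z') (\<phi> (k \<otimes> inv g) p) \<le> \<epsilon> + 2 * \<kappa>"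
          using dist_through[OF znA[OF k False] near'[OF k kN]] k g z z' p by simp
        have "d (\<phi> k z') (\<phi> (k \<otimes> inv g) q) \<le> \<epsilon> + 2 * \<kappa> + \<kappa>"
          using dist_through[OF 1 pq[OF _ False]] k g z' p q by simp
        then show ?thesis using r \<epsilon> \<kappa> by simp
      qed
    next
      case False
      then have "k \<otimes> inv g \<notin> A" using M_I[OF f] k_inv h g by auto
      then have 1: "d (\<phi> k z') (l k) \<le> \<epsilon> + \<kappa>"
        using dist_through[OF znA[OF k] tracksD(4)[OF tr k]] tracksD(3)[OF tr k] k z z' by simp
      have "d (\<phi> k z') (\<phi> f (l h)) \<le> \<epsilon> + \<kappa> + 4 * \<kappa>"
        using dist_through[OF 1 tracks_consistent[OF tr h f, folded k_def]] tracksD(3)[OF tr] fG h k z'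
        by simp
      then show ?thesis using False \<epsilon> by (simp add: relabel_def)
    qed
    then show "d (\<phi> f (\<phi> h z')) (\<phi> f (relabel g l h)) \<le> c"
      using fG h z' by (simp add: k_def composition_rule)
  qed (use h z' rl in auto)
  \<comment> \<open>The old labels on \<open>N g\<close> are those of \<open>w\<close>, so the
    closeness of \<open>z\<close> to \<open>p\<close> passes to the fixed point \<open>w\<close>,
    where later swaps cannot spoil it.\<close>
  have m2: "d (\<phi> h w) (\<phi> (h \<otimes> inv g) p) \<le> 3 * \<kappa>" if h: "h \<in> carrier G" "h \<otimes> inv g \<in> N" for h
  proof -
    have "l h = \<phi> h w" using tracksD(5)[OF tr h(1)] sep1[OF h(1) _ h(2)] by blast
    then have 1: "d (\<phi> h w) (\<phi> h z) \<le> \<kappa>" using tracksD(4)[OF tr h(1)] by (simp add: commute)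
    have "d (\<phi> h w) (\<phi> (h \<otimes> inv g) p) \<le> \<kappa> + 2 * \<kappa>"
      using dist_through[OF 1 near'[OF h]] h(1) g w z p by simp
    then show ?thesis by simp
  qed
  have m3: "relabel g l h = \<phi> h w"
    if "h \<in> carrier G" "\<forall>g'\<in>insert g P. h \<otimes> inv g' \<notin> M" for h
    using that tracksD(5)[OF tr] by (simp add: relabel_def)
  have m4: "relabel g l h = \<phi> (h \<otimes> inv g') q"
    if "h \<in> carrier G" "g' \<in> insert g P" "h \<otimes> inv g' \<in> M" for h g'
  proof (cases "h \<otimes> inv g \<in> M")
    case True
    then have "g' \<notin> P" using sep2[OF that(1) _ True] that(3) M_subset_N by blast
    then show ?thesis using that by (simp add: relabel_def)
  next
    case False
    then show ?thesis using that tracksD(6)[OF tr that(1) _ that(3)] by (auto simp: relabel_def)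
  qed
  have m5: "g'' = g'"
    if h: "h \<in> carrier G" "h \<otimes> inv g' \<in> N" "h \<otimes> inv g'' \<in> M"
      and mem: "g' \<in> insert g P" "g'' \<in> insert g P" for h g' g''
  proof (cases "g' = g")
    case True
    then have "g'' \<notin> P" using sep1[OF h(1)] h by blast
    then show ?thesis using mem True by simp
  next
    case False
    then have g': "g' \<in> P" using mem by simp
    then have "g'' \<noteq> g" using sep2[OF h(1) g'] h by blast
    then show ?thesis using mem tracksD(8)[OF tr h(1) g' _ h(2,3)] by simp
  qed
  have "tracks (insert g P) (relabel g l) z'"
    unfolding tracks_def
  proof (intro conjI ballI impI)
    fix h g' assume "h \<in> carrier G" "g' \<in> insert g P" "h \<otimes> inv g' \<in> N"
    then show "d (\<phi> h w) (\<phi> (h \<otimes> inv g') p) \<le> 3 * \<kappa>"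
      using m2 tracksD(7)[OF tr] by (cases "g' = g") simp_all
  qed (use z' g P in \<open>auto intro: rl m1 m3 m4 m5\<close>)
  then show ?thesis using swapped by blast
qed

end

section \<open>Return times\<close>

context compact_metric_action
begin

text \<open>Some element of the finite \<open>K\<close> brings each \<open>\<phi> g p\<close> back
  near \<open>p\<close>, so finitely many returns would make the group finite.\<close>

lemma infinite_returns:
  assumes min: "minimal_action G X \<phi>" and inf: "infinite (carrier G)" and p: "p \<in> topspace X"
    and V: "finite V" "V \<subseteq> carrier G" and "0 < \<eta>"
  shows "infinite {g \<in> carrier G. \<forall>h\<in>V. d (\<phi> h (\<phi> g p)) (\<phi> h p) \<le> \<eta>}" (is "infinite ?R")
proof
  assume "finite ?R"
  obtain K where K: "finite K" "K \<subseteq> carrier G"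
    "\<forall>z\<in>topspace X. \<exists>g\<in>K. \<forall>h\<in>V. d (\<phi> h (\<phi> g z)) (\<phi> h p) \<le> \<eta>"
    using syndetic_returns[OF min p V \<open>0 < \<eta>\<close>] by (elim exE conjE)
  have "carrier G \<subseteq> quot K ?R"
  proof
    fix g assume g: "g \<in> carrier G"
    then have "\<phi> g p \<in> topspace X" using p by simp
    then obtain k where k: "k \<in> K" "\<forall>h\<in>V. d (\<phi> h (\<phi> k (\<phi> g p))) (\<phi> h p) \<le> \<eta>"
      using K(3) by blast
    then have kG: "k \<in> carrier G" using K(2) by blast
    then have "k \<otimes> g \<in> ?R"
      using k(2) g p by (simp add: composition_rule)
    then show "g \<in> quot K ?R"
      by (rule quotI[OF _ k(1) kG g])
  qed
  from finite_subset[OF this finite_quot[OF K(1) \<open>finite ?R\<close>]] show False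
    using inf by simp
qed

lemma separated_subset:
  assumes R: "infinite R" "R \<subseteq> carrier G" and D: "finite D" "D \<subseteq> carrier G"
  shows "\<exists>Q\<subseteq>R. finite Q \<and> card Q = n \<and> (\<forall>g\<in>Q. \<forall>g'\<in>Q. g \<noteq> g' \<longrightarrow> g \<otimes> inv g' \<notin> D)"
proof (induction n)
  case 0
  show ?case by (intro exI[of _ "{}"]) auto
next
  case (Suc n)
  then obtain Q where Q: "Q \<subseteq> R" "finite Q" "card Q = n" "\<forall>g\<in>Q. \<forall>g'\<in>Q. g \<noteq> g' \<longrightarrow> g \<otimes> inv g' \<notin> D"
    by blast
  \<comment> \<open>The next element is chosen greedily. The three sets guard against both orders of
    the quotient, as \<open>D\<close> may fail to be symmetric, and against repetition.\<close>
  let ?bad = "(\<lambda>(e, g'). e \<otimes> g') ` (D \<times> Q) \<union> quot D Q \<union> Q"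
  have "finite ?bad" using D Q finite_quot by simp
  then obtain g where g: "g \<in> R" "g \<notin> ?bad"
    using finite_subset[of R ?bad] R(1) by blast
  have gG: "g \<in> carrier G" using g R by blast
  have 1: "g \<otimes> inv g' \<notin> D" if "g' \<in> Q" for g'
  proof
    assume "g \<otimes> inv g' \<in> D"
    moreover have "g' \<in> carrier G" using that Q(1) R(2) by blast
    then have "g = (g \<otimes> inv g') \<otimes> g'" using gG by (simp add: m_assoc)
    ultimately have "g \<in> (\<lambda>(e, g'). e \<otimes> g') ` (D \<times> Q)" using that by force
    then show False using g by blast
  qed
  have 2: "g' \<otimes> inv g \<notin> D" if "g' \<in> Q" for g'
  proof
    assume *: "g' \<otimes> inv g \<in> D"
    have "g' \<in> carrier G" using that Q(1) R(2) by blast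
    then have "(g' \<otimes> inv g) \<otimes> g \<in> Q" using gG that by (simp add: m_assoc)
    moreover have "g' \<otimes> inv g \<in> carrier G" using * D(2) by blast
    ultimately have "g \<in> quot D Q" using quotI[OF _ *] gG by blast
    then show False using g by blast
  qed
  show ?case
  proof (intro exI[of _ "insert g Q"] conjI ballI impI)
    fix x y assume "x \<in> insert g Q" "y \<in> insert g Q" "x \<noteq> y"
    then show "x \<otimes> inv y \<notin> D" using Q(4) 1 2 by blast
  qed (use Q(1-3) g in auto)
qed

lemma memory_set_mono:
  assumes "memory_set G X d \<phi> \<epsilon> \<delta> A B" "\<delta>' \<le> \<delta>"
  shows "memory_set G X d \<phi> \<epsilon> \<delta>' A B"
  using assms unfolding memory_set_def by (meson order_trans)

end

section \<open>Families of swapped points and recurrence\<close>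

context swap_step
begin

text \<open>Separation with \<open>B \<union> N\<close> in place of \<open>N\<close> keeps earlier
  swaps from disturbing \<open>p\<close> on the memory set of the next place. Tracking error
  \<open>\<kappa>\<close> and return error \<open>\<kappa>\<close> then give the
  \<open>2 * \<kappa>\<close> of \<open>tracks_insert\<close>.\<close>

lemma tracks_returns:
  assumes wp: "w = p" and Q: "finite Q" "Q \<subseteq> carrier G"
    and ret: "\<And>g h. \<lbrakk>g \<in> Q; h \<in> B \<union> N\<rbrakk> \<Longrightarrow> d (\<phi> h (\<phi> g p)) (\<phi> h p) \<le> \<kappa>"
    and sep: "\<And>g g'. \<lbrakk>g \<in> Q; g' \<in> Q; g \<noteq> g'\<rbrakk> \<Longrightarrow> g \<otimes> inv g' \<notin> quot (B \<union> N) M \<union> quot M N"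
  shows "\<exists>l z. tracks Q l z"
  using Q ret sep
proof (induction Q)
  case empty
  then show ?case using tracks_empty by blast
next
  case (insert g S)
  have "\<exists>l z. tracks S l z"
    by (rule insert.IH) (use insert.prems in auto)
  then obtain l z where tr: "tracks S l z" by blast
  have g: "g \<in> carrier G" using insert by blast
  have sep: "g \<otimes> inv g' \<notin> quot (B \<union> N) M \<union> quot M N" if "g' \<in> S" for g'
    using insert.prems(3)[of g g'] insert.hyps(2) that by blast
  have BG: "B \<subseteq> carrier G" using mem by (simp add: memory_set_def)
  have "d (\<phi> h (\<phi> g z)) (\<phi> h p) \<le> 2 * \<kappa>" if h: "h \<in> B \<union> N" for h
  proof -
    have hG: "h \<in> carrier G" using h BG N by blast
    define k where "k = h \<otimes> g"
    have k: "k \<in> carrier G" "k \<otimes> inv g = h" using hG g by (simp_all add: k_def m_assoc)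
    have "k \<otimes> inv g' \<notin> M" if "g' \<in> S" for g'
      using quot_right_translates[of k g "B \<union> N" g' M] k h g sep[OF that] tracksD(2)[OF tr] that by auto
    then have "l k = \<phi> k p" using tracksD(5)[OF tr k(1)] wp by blast
    then have 1: "d (\<phi> k z) (\<phi> k p) \<le> \<kappa>" using tracksD(4)[OF tr k(1)] by simp
    have "d (\<phi> k p) (\<phi> h p) \<le> \<kappa>"
      using insert.prems(2)[of g h] h hG g p by (simp add: k_def composition_rule)
    from dist_through[OF 1 this] show ?thesis
      using k(1) hG g p tracksD(1)[OF tr] by (simp add: k_def composition_rule)
  qed
  moreover have "g \<otimes> inv g' \<notin> quot N M \<union> quot M N" if "g' \<in> S" for g'
    using sep[OF that] by (auto simp: quot_def)
  ultimately have "\<exists>z'. tracks (insert g S) (relabel g l) z' \<and>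
      (\<forall>h\<in>carrier G. d (\<phi> h z') (if h \<otimes> inv g \<in> A then \<phi> (h \<otimes> inv g) q else \<phi> h z) \<le> \<epsilon>)"
    by (intro tracks_insert[OF tr g]) simp_all
  then show ?case by blast
qed

text \<open>At \<open>a \<otimes> g\<close> the first point shows \<open>q\<close>, whereas the
  second still shows \<open>w\<close>, which resembles \<open>p\<close> there. The loss
  \<open>5 * \<kappa>\<close> consists of two tracking errors and the \<open>3 * \<kappa>\<close>
  between \<open>w\<close> and \<open>p\<close>.\<close>

lemma tracks_far:
  assumes tr: "tracks S l z" "tracks T l' z'" and g: "g \<in> S"
    and sep: "\<And>g'. g' \<in> T \<Longrightarrow> g \<otimes> inv g' \<notin> quot N M"
    and a: "a \<in> A" "c < d (\<phi> a p) (\<phi> a q)"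
  shows "c - 5 * \<kappa> < d (\<phi> (a \<otimes> g) z) (\<phi> (a \<otimes> g) z')"
proof -
  have G: "g \<in> carrier G" "a \<in> carrier G" using g a A tracksD(2)[OF tr(1)] by auto
  define k where "k = a \<otimes> g"
  have k: "k \<in> carrier G" "k \<otimes> inv g = a" using G by (simp_all add: k_def m_assoc)
  have aMN: "a \<in> M" "a \<in> N" using a A_subset_M M_subset_N by auto
  have "d (\<phi> k z) (\<phi> a q) \<le> \<kappa>"
    using tracksD(4)[OF tr(1) k(1)] tracksD(6)[OF tr(1) k(1) g] k(2) aMN by simp
  moreover have "k \<otimes> inv g' \<notin> M" if "g' \<in> T" for g'
    using quot_right_translates[of k g N g' M] k aMN G sep[OF that] tracksD(2)[OF tr(2)] that by auto
  then have "l' k = \<phi> k w" by (rule tracksD(5)[OF tr(2) k(1)])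
  then have "d (\<phi> k z') (\<phi> k w) \<le> \<kappa>"
    using tracksD(4)[OF tr(2) k(1)] by simp
  moreover have "d (\<phi> k w) (\<phi> a p) \<le> 3 * \<kappa>"
    using tracksD(7)[OF tr(1) k(1) g] k(2) aMN by simp
  moreover have X: "\<phi> k z \<in> topspace X" "\<phi> k z' \<in> topspace X" "\<phi> k w \<in> topspace X" "\<phi> a p \<in> topspace X" "\<phi> a q \<in> topspace X"
    using k G tracksD(1)[OF tr(1)] tracksD(1)[OF tr(2)] w p q by auto
  ultimately show ?thesis
    using a(2) triangle[OF X(4,3,5)] triangle[OF X(3,2,5)] triangle[OF X(2,1,5)]
    by (simp add: k_def commute)
qed

lemma tracks_off:
  assumes "tracks P l z" "h \<in> carrier G" "\<And>g. g \<in> P \<Longrightarrow> h \<otimes> inv g \<notin> M"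
  shows "d (\<phi> h z) (\<phi> h w) \<le> \<kappa>"
  using tracksD(4)[OF assms(1,2)] tracksD(5)[OF assms(1,2) assms(3)] by simp

text \<open>
  The invariant of the induction on the number of swaps is that the labels exclude \<open>p\<close> at all places
  \<open>e \<otimes> g\<close> with \<open>e \<in> E\<close> and \<open>g \<in> P\<close>; hence the next place at which \<open>p\<close> occurs is separated from \<open>P\<close>.
\<close>

lemma recurrence_not_excluded:
  assumes min: "minimal_action G X \<phi>" and "A \<noteq> {}" and C: "C \<subseteq> N"
    and excl: "\<And>e. e \<in> quot N M \<union> quot M N \<Longrightarrow> \<exists>t\<in>C. \<epsilon> + 7 * \<kappa> < d (\<phi> t (\<phi> e q)) (\<phi> t p)"
  shows False
proof -
  define E where "E = quot N M \<union> quot M N"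
  have E: "finite E" "E \<subseteq> carrier G"
    unfolding E_def using finite_quot quot_subset M N by simp_all
  have CG: "finite C" "C \<subseteq> carrier G" using C N finite_subset by auto
  have quot_C_M: "quot C M \<subseteq> E" using C by (auto simp: quot_def E_def)
  obtain a where "a \<in> A" using \<open>A \<noteq> {}\<close> by blast
  then have "a \<in> carrier G" "a \<in> M" "a \<in> N" using A A_subset_M M_subset_N by auto
  then have "\<one> \<in> quot M N" using quotI[of a \<one> N M] by simp
  then have one: "\<one> \<in> E" by (simp add: E_def)
  \<comment> \<open>\<open>B \<union> N\<close> permits the swap, \<open>C\<close> tests an
    occurrence of \<open>p\<close> against the labels, and the products allow a comparison with
    \<open>q\<close> at \<open>t \<otimes> e\<close>.\<close>
  define V where "V = B \<union> N \<union> C \<union> (\<lambda>(t, e). t \<otimes> e) ` (C \<times> E)"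
  have "finite B" "B \<subseteq> carrier G" using mem by (simp_all add: memory_set_def)
  then have V: "finite V" "V \<subseteq> carrier G" using N CG E by (auto simp: V_def)
  have "0 < 2 * \<kappa>" using \<kappa> by simp
  from syndetic_returns[OF min p V this]
  obtain K where K: "finite K" "K \<subseteq> carrier G"
    "\<forall>z\<in>topspace X. \<exists>g\<in>K. \<forall>h\<in>V. d (\<phi> h (\<phi> g z)) (\<phi> h p) \<le> 2 * \<kappa>"
    by (elim exE conjE)
  \<comment> \<open>The threshold \<open>3 * \<kappa>\<close> is the tracking error plus the return
    tolerance, so a label beyond it rules out an occurrence of \<open>p\<close>.\<close>
  have "\<exists>P l z. tracks P l z \<and> finite P \<and> P \<subseteq> K \<and> card P = n \<and>
      (\<forall>g\<in>P. \<forall>e\<in>E. \<exists>t\<in>C. 3 * \<kappa> < d (l (t \<otimes> (e \<otimes> g))) (\<phi> t p))" for n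
  proof (induction n)
    case 0
    show ?case
      using tracks_empty by (intro exI[of _ "{}"] exI[of _ "\<lambda>h. \<phi> h w"] exI[of _ w]) simp
  next
    case (Suc n)
    then obtain P l z where tr: "tracks P l z" and P: "finite P" "P \<subseteq> K" "card P = n"
      and far: "\<And>g e. \<lbrakk>g \<in> P; e \<in> E\<rbrakk> \<Longrightarrow> \<exists>t\<in>C. 3 * \<kappa> < d (l (t \<otimes> (e \<otimes> g))) (\<phi> t p)"
      by blast
    note PG = tracksD(2)[OF tr]
    note z = tracksD(1)[OF tr]
    obtain g where g: "g \<in> K" and "\<forall>h\<in>V. d (\<phi> h (\<phi> g z)) (\<phi> h p) \<le> 2 * \<kappa>"
      using K(3)[rule_format, OF z] by (elim bexE)
    then have near: "d (\<phi> h (\<phi> g z)) (\<phi> h p) \<le> 2 * \<kappa>" if "h \<in> V" for h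
      using that by blast
    have gG: "g \<in> carrier G" using g K by blast
    have sep: "g \<otimes> inv g' \<notin> E" if g': "g' \<in> P" for g'
    proof
      assume *: "g \<otimes> inv g' \<in> E"
      have "g' \<in> carrier G" using g' PG by blast
      then have "(g \<otimes> inv g') \<otimes> g' = g" using gG by (simp add: m_assoc)
      then obtain t where t: "t \<in> C" "3 * \<kappa> < d (l (t \<otimes> g)) (\<phi> t p)"
        using far[OF g' *] by auto
      have tG: "t \<in> carrier G" "t \<otimes> g \<in> carrier G" using t CG gG by auto
      have "d (l (t \<otimes> g)) (\<phi> (t \<otimes> g) z) \<le> \<kappa>"
        using tracksD(4)[OF tr tG(2)] by (simp add: commute)
      moreover have "d (\<phi> (t \<otimes> g) z) (\<phi> t p) \<le> 2 * \<kappa>"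
        using near[of t] t(1) tG gG z by (simp add: V_def composition_rule)
      ultimately show False
        using dist_through[of "l (t \<otimes> g)" "\<phi> (t \<otimes> g) z" \<kappa> "\<phi> t p" "2 * \<kappa>"] t(2) tG tracksD(3)[OF tr tG(2)] z p
        by simp
    qed
    have "g \<notin> P" using sep[of g] one gG by auto
    have "\<exists>z'. tracks (insert g P) (relabel g l) z' \<and>
      (\<forall>h\<in>carrier G. d (\<phi> h z') (if h \<otimes> inv g \<in> A then \<phi> (h \<otimes> inv g) q else \<phi> h z) \<le> \<epsilon>)"
    proof (rule tracks_insert[OF tr gG])
      show "d (\<phi> h (\<phi> g z)) (\<phi> h p) \<le> 2 * \<kappa>" if "h \<in> B \<union> N" for h
        by (rule near) (use that in \<open>auto simp: V_def\<close>)
      show "g \<otimes> inv g' \<notin> quot N M \<union> quot M N" if "g' \<in> P" for g'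
        using sep[OF that] unfolding E_def .
    qed
    then obtain z' where tr': "tracks (insert g P) (relabel g l) z'" and
      swapped: "\<forall>h\<in>carrier G. d (\<phi> h z') (if h \<otimes> inv g \<in> A then \<phi> (h \<otimes> inv g) q else \<phi> h z) \<le> \<epsilon>"
      by (elim exE conjE)
    note z' = tracksD(1)[OF tr']
    \<comment> \<open>Of the margin \<open>\<epsilon> + 7 * \<kappa>\<close>, passing from
      \<open>q\<close> to the new point costs \<open>\<epsilon> + 3 * \<kappa>\<close> and passing
      to its label \<open>\<kappa>\<close>; the invariant needs the remaining
      \<open>3 * \<kappa>\<close>.\<close>
    have new: "\<exists>t\<in>C. 3 * \<kappa> < d (relabel g l (t \<otimes> (e \<otimes> g))) (\<phi> t p)" if e: "e \<in> E" for e
    proof -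
      obtain t where t: "t \<in> C" "\<epsilon> + 7 * \<kappa> < d (\<phi> t (\<phi> e q)) (\<phi> t p)"
        using excl e unfolding E_def by blast
      define k where "k = t \<otimes> (e \<otimes> g)"
      have G: "t \<in> carrier G" "e \<in> carrier G" using t e CG E by auto
      have k: "k \<in> carrier G" "k \<otimes> inv g = t \<otimes> e" using G gG by (simp_all add: k_def m_assoc)
      have X: "\<phi> k z \<in> topspace X" "\<phi> k z' \<in> topspace X" "\<phi> (t \<otimes> e) p \<in> topspace X"
        "\<phi> (t \<otimes> e) q \<in> topspace X" "\<phi> t p \<in> topspace X" "relabel g l k \<in> topspace X"
        using k G z z' p q tracksD(3)[OF tr' k(1)] by auto
      have "d (\<phi> k z') (\<phi> (t \<otimes> e) q) \<le> \<epsilon> + 3 * \<kappa>"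
      proof (cases "t \<otimes> e \<in> A")
        case True
        then show ?thesis using swapped[rule_format, OF k(1)] k(2) \<kappa> by simp
      next
        case False
        have "t \<otimes> e \<in> V" using t e by (auto simp: V_def)
        then have "d (\<phi> k z) (\<phi> (t \<otimes> e) p) \<le> 2 * \<kappa>"
          using near[of "t \<otimes> e"] G gG z by (simp add: k_def composition_rule)
        moreover have "d (\<phi> (t \<otimes> e) p) (\<phi> (t \<otimes> e) q) \<le> \<kappa>" using pq[OF _ False] G by simp
        moreover have "d (\<phi> k z') (\<phi> k z) \<le> \<epsilon>" using swapped[rule_format, OF k(1)] k(2) False by simp
        ultimately show ?thesis
          using triangle[OF X(2,1,4)] triangle[OF X(1,3,4)] by simp
      qed
      moreover have "d (\<phi> k z') (relabel g l k) \<le> \<kappa>" using tracksD(4)[OF tr' k(1)] .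
      moreover have "\<phi> t (\<phi> e q) = \<phi> (t \<otimes> e) q" using G q by (simp add: composition_rule)
      ultimately have "3 * \<kappa> < d (relabel g l k) (\<phi> t p)"
        using t(2) triangle[OF X(4,2,5)] triangle[OF X(2,6,5)] by (simp add: commute)
      then show ?thesis using t(1) by (auto simp: k_def)
    qed
    \<comment> \<open>Either the new swap leaves all labels tested at \<open>e \<otimes> g'\<close>
      unchanged, or \<open>e \<otimes> g' = e' \<otimes> g\<close> with \<open>e'\<close> in
      \<open>E\<close>, and the new swap itself excludes \<open>p\<close> there.\<close>
    have "\<exists>t\<in>C. 3 * \<kappa> < d (relabel g l (t \<otimes> (e \<otimes> g'))) (\<phi> t p)" if g': "g' \<in> P" and e: "e \<in> E" for g' e
    proof (cases "\<exists>t\<in>C. (t \<otimes> (e \<otimes> g')) \<otimes> inv g \<in> M")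
      case True
      then obtain t where t: "t \<in> C" "(t \<otimes> (e \<otimes> g')) \<otimes> inv g \<in> M" by blast
      define e' where "e' = (e \<otimes> g') \<otimes> inv g"
      have G: "t \<in> carrier G" "e \<in> carrier G" "g' \<in> carrier G" using t e g' CG E PG by auto
      have "e' \<in> quot C M"
        by (rule quotI[of t]) (use t G gG in \<open>simp_all add: e'_def m_assoc\<close>)
      then have "e' \<in> E" using quot_C_M by blast
      moreover have "e' \<otimes> g = e \<otimes> g'" using G gG by (simp add: e'_def m_assoc)
      ultimately show ?thesis using new[of e'] by simp
    next
      case False
      then have "relabel g l (t \<otimes> (e \<otimes> g')) = l (t \<otimes> (e \<otimes> g'))" if "t \<in> C" for t
        using that by (simp add: relabel_def)
      then show ?thesis using far[OF g' e] by auto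
    qed
    then have "\<forall>g'\<in>insert g P. \<forall>e\<in>E. \<exists>t\<in>C. 3 * \<kappa> < d (relabel g l (t \<otimes> (e \<otimes> g'))) (\<phi> t p)"
      using new by blast
    moreover have "finite (insert g P)" "insert g P \<subseteq> K" "card (insert g P) = Suc n"
      using P g \<open>g \<notin> P\<close> by simp_all
    ultimately show ?case
      using tr' by blast
  qed
  from this[of "Suc (card K)"] obtain P where P: "P \<subseteq> K" "card P = Suc (card K)"
    by (elim exE conjE)
  show False
    using card_mono[OF K(1) P(1)] P(2) by simp
qed

end

section \<open>Counting swapped points against translates\<close>

lemma square_less_two_power: "\<exists>k::nat. 0 < k \<and> b * k\<^sup>2 < 2 ^ k"
proof -
  \<comment> \<open>With exponent \<open>4 * n\<close>, three factors \<open>2 ^ n\<close> dominate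
    the cube of \<open>n\<close>; the size of \<open>n\<close> absorbs \<open>b\<close> and the 16
    from squaring.\<close>
  define n where "n = 16 * b + 1"
  then have "0 < n" by simp
  have "b * (4 * n)\<^sup>2 = (16 * b) * n\<^sup>2" by (simp add: power_mult_distrib)
  also have "\<dots> \<le> n * n\<^sup>2" by (simp add: n_def)
  also have "\<dots> < 2 ^ n * (2 ^ n)\<^sup>2 * 2 ^ n"
  proof -
    have "n * n\<^sup>2 \<le> 2 ^ n * (2 ^ n)\<^sup>2"
      by (intro mult_le_mono power_mono) (auto simp: less_imp_le)
    also have "\<dots> \<le> 2 ^ n * (2 ^ n)\<^sup>2 * 2 ^ n" by simp
    moreover have "n * n\<^sup>2 < 2 ^ n * (2 ^ n)\<^sup>2"
      using \<open>0 < n\<close> by (intro mult_less_le_imp_less power_mono) (auto simp: less_imp_le)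
    ultimately show ?thesis by linarith
  qed
  also have "\<dots> = 2 ^ (4 * n)" by (simp add: power_add[symmetric] power_mult[symmetric])
  finally show ?thesis using \<open>0 < n\<close> by (intro exI[of _ "4 * n"]) simp
qed

context swap_step
begin

text \<open>By pigeonhole, if all \<open>2 ^ k\<close> points were approximated on \<open>C\<close>
  by translates from \<open>E\<close>, two would share a translate, although
  \<open>tracks_far\<close> separates them at a place swapped in only one. \<open>E\<close> is built
  from \<open>A'\<close> because \<open>z\<close> and \<open>p\<close> form the pair of a second
  swap step.\<close>

lemma exists_excluding_point:
  assumes min: "minimal_action G X \<phi>" and inf: "infinite (carrier G)" and wp: "w = p"
    and a: "a \<in> A" "c < d (\<phi> a p) (\<phi> a q)" and c: "2 * \<epsilon> + 19 * \<kappa> \<le> c"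
  shows "\<exists>A' C z. finite A' \<and> A' \<subseteq> carrier G \<and> A' \<noteq> {} \<and> C \<subseteq> A' \<and> z \<in> topspace X \<and>
    (\<forall>h\<in>carrier G - A'. d (\<phi> h z) (\<phi> h p) \<le> \<kappa>) \<and>
    (\<forall>e\<in>quot (F <#> quot F A') (quot F A') \<union> quot (quot F A') (F <#> quot F A').
       \<exists>t\<in>C. \<epsilon> + 7 * \<kappa> < d (\<phi> t (\<phi> e p)) (\<phi> t z))"
proof -
  have B: "finite B" "B \<subseteq> carrier G" using mem by (simp_all add: memory_set_def)
  have aG: "a \<in> carrier G" "a \<in> M" using a A A_subset_M by auto
  define D where "D = quot (B \<union> N) M \<union> quot M N"
  have D: "finite D" "D \<subseteq> carrier G"
    unfolding D_def using finite_quot quot_subset B M N by simp_all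
  define R where "R = {g \<in> carrier G. \<forall>h\<in>B \<union> N. d (\<phi> h (\<phi> g p)) (\<phi> h p) \<le> \<kappa>}"
  have R: "infinite R" "R \<subseteq> carrier G"
    unfolding R_def using infinite_returns[OF min inf p, of "B \<union> N" \<kappa>] B N \<kappa> by auto
  \<comment> \<open>As \<open>card A' \<le> card M * k\<close>, this makes the bound of
    \<open>card_exclusion_le\<close> for \<open>E\<close> smaller than the number of subsets of
    \<open>Q\<close>.\<close>
  obtain k where k: "0 < k" "2 * (card F ^ 3 * card M ^ 2) * k\<^sup>2 < 2 ^ k"
    using square_less_two_power by blast
  obtain Q where Q: "Q \<subseteq> R" "finite Q" "card Q = k"
    and sep: "\<forall>g\<in>Q. \<forall>g'\<in>Q. g \<noteq> g' \<longrightarrow> g \<otimes> inv g' \<notin> D"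
    using separated_subset[OF R D, of k] by (elim exE conjE)
  have QG: "Q \<subseteq> carrier G" using Q(1) R(2) by (rule order_trans)
  have "\<exists>l z. tracks S l z" if "S \<subseteq> Q" for S
  proof (rule tracks_returns[OF wp])
    show "finite S" "S \<subseteq> carrier G" using that Q(2) QG finite_subset by auto
    show "d (\<phi> h (\<phi> g p)) (\<phi> h p) \<le> \<kappa>" if "g \<in> S" "h \<in> B \<union> N" for g h
    proof -
      have "g \<in> R" using \<open>S \<subseteq> Q\<close> \<open>g \<in> S\<close> Q(1) by blast
      then show ?thesis using that(2) by (simp add: R_def)
    qed
    show "g \<otimes> inv g' \<notin> quot (B \<union> N) M \<union> quot M N" if "g \<in> S" "g' \<in> S" "g \<noteq> g'" for g g'
      using sep that \<open>S \<subseteq> Q\<close> unfolding D_def by blast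
  qed
  then obtain lab pt where tr: "\<And>S. S \<subseteq> Q \<Longrightarrow> tracks S (lab S) (pt S)"
    by metis
  define A' where "A' = M <#> Q"
  define C where "C = (\<lambda>g. a \<otimes> g) ` Q"
  define E where "E = quot (F <#> quot F A') (quot F A') \<union> quot (quot F A') (F <#> quot F A')"
  have A': "finite A'" "A' \<subseteq> carrier G"
    unfolding A'_def using finite_set_mult set_mult_closed M Q(2) QG by simp_all
  have C: "C \<subseteq> A'"
    using aG by (auto simp: C_def A'_def set_mult_def)
  have "Q \<noteq> {}" using k(1) Q(3) by auto
  then have "A' \<noteq> {}" using C by (auto simp: C_def)
  have EG: "finite E" "E \<subseteq> carrier G"
    unfolding E_def using finite_quot finite_set_mult set_mult_closed quot_subset F A' by simp_all
  have "card A' \<le> card M * k"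
    unfolding A'_def using card_set_mult_le[of M Q] M Q by simp
  then have "2 * (card F ^ 3 * (card A')\<^sup>2) \<le> 2 * (card F ^ 3 * (card M * k)\<^sup>2)"
    by (intro mult_le_mono order_refl power_mono) simp_all
  also have "\<dots> = 2 * (card F ^ 3 * card M ^ 2) * k\<^sup>2"
    by (simp add: power_mult_distrib)
  also have "\<dots> < 2 ^ k" by (rule k(2))
  finally have "card E < 2 ^ k"
    using card_exclusion_le[OF F(1) A'(1)] unfolding E_def by linarith
  have "\<exists>S\<subseteq>Q. \<forall>e\<in>E. \<exists>t\<in>C. \<epsilon> + 7 * \<kappa> < d (\<phi> t (\<phi> e p)) (\<phi> t (pt S))"
  proof (rule ccontr)
    assume "\<not> ?thesis"
    then have "\<forall>S\<in>Pow Q. \<exists>e\<in>E. \<forall>t\<in>C. d (\<phi> t (\<phi> e p)) (\<phi> t (pt S)) \<le> \<epsilon> + 7 * \<kappa>"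
      by (simp add: not_less)
    then obtain ex where ex: "\<forall>S\<in>Pow Q. ex S \<in> E \<and> (\<forall>t\<in>C. d (\<phi> t (\<phi> (ex S) p)) (\<phi> t (pt S)) \<le> \<epsilon> + 7 * \<kappa>)"
      by (metis (no_types, lifting))
    have subset: "S \<subseteq> T" if S: "S \<subseteq> Q" and T: "T \<subseteq> Q" and eq: "ex S = ex T" for S T
    proof
      fix g assume g: "g \<in> S"
      show "g \<in> T"
      proof (rule ccontr)
        assume "g \<notin> T"
        have "g \<otimes> inv g' \<notin> quot N M" if "g' \<in> T" for g'
        proof -
          have "g \<in> Q" "g' \<in> Q" "g \<noteq> g'" using S T g that \<open>g \<notin> T\<close> by auto
          then have "g \<otimes> inv g' \<notin> D" using sep by blast
          then show ?thesis by (auto simp: D_def quot_def)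
        qed
        then have far: "c - 5 * \<kappa> < d (\<phi> (a \<otimes> g) (pt S)) (\<phi> (a \<otimes> g) (pt T))"
          using tracks_far[OF tr[OF S] tr[OF T] g _ a] by blast
        have gG: "g \<in> carrier G" using g S QG by blast
        have "a \<otimes> g \<in> C" using g S by (auto simp: C_def)
        moreover have "\<forall>t\<in>C. d (\<phi> t (\<phi> (ex S) p)) (\<phi> t (pt S)) \<le> \<epsilon> + 7 * \<kappa>"
          "\<forall>t\<in>C. d (\<phi> t (\<phi> (ex S) p)) (\<phi> t (pt T)) \<le> \<epsilon> + 7 * \<kappa>"
          using ex[rule_format, of S] ex[rule_format, of T] S T eq by simp_all
        ultimately have le: "d (\<phi> (a \<otimes> g) (\<phi> (ex S) p)) (\<phi> (a \<otimes> g) (pt S)) \<le> \<epsilon> + 7 * \<kappa>"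
          "d (\<phi> (a \<otimes> g) (\<phi> (ex S) p)) (\<phi> (a \<otimes> g) (pt T)) \<le> \<epsilon> + 7 * \<kappa>"
          by simp_all
        have "ex S \<in> carrier G" using ex S EG(2) by auto
        then have X: "\<phi> (a \<otimes> g) (\<phi> (ex S) p) \<in> topspace X" "\<phi> (a \<otimes> g) (pt S) \<in> topspace X"
          "\<phi> (a \<otimes> g) (pt T) \<in> topspace X"
          using aG gG p tracksD(1)[OF tr[OF S]] tracksD(1)[OF tr[OF T]] by simp_all
        \<comment> \<open>The two approximations give at most
          \<open>2 * \<epsilon> + 14 * \<kappa>\<close>, which the assumption on \<open>c\<close>
          keeps below or equal to \<open>c - 5 * \<kappa>\<close>.\<close>
        show False
          using far le triangle[OF X(2,1,3)] c by (simp add: commute)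
      qed
    qed
    have "inj_on ex (Pow Q)"
      using subset by (intro inj_onI subset_antisym) auto
    moreover have "ex ` Pow Q \<subseteq> E" using ex by blast
    ultimately have "card (Pow Q) \<le> card E" using EG(1) card_inj_on_le by blast
    then show False using \<open>card E < 2 ^ k\<close> Q(2,3) by (simp add: card_Pow)
  qed
  then obtain S where S: "S \<subseteq> Q"
    and excl: "\<forall>e\<in>E. \<exists>t\<in>C. \<epsilon> + 7 * \<kappa> < d (\<phi> t (\<phi> e p)) (\<phi> t (pt S))"
    by (elim exE conjE)
  have "d (\<phi> h (pt S)) (\<phi> h p) \<le> \<kappa>" if h: "h \<in> carrier G - A'" for h
  proof -
    have "h \<otimes> inv g \<notin> M" if "g \<in> S" for g
    proof
      assume "h \<otimes> inv g \<in> M"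
      moreover have "g \<in> carrier G" using that S QG by blast
      then have "h = (h \<otimes> inv g) \<otimes> g" using h by (simp add: m_assoc)
      ultimately have "h \<in> A'" using that S unfolding A'_def set_mult_def by blast
      then show False using h by blast
    qed
    then show ?thesis using tracks_off[OF tr[OF S], of h] h wp by blast
  qed
  then show ?thesis
    using A' \<open>A' \<noteq> {}\<close> C tracksD(1)[OF tr[OF S]] excl unfolding E_def
    by (intro exI[of _ A'] exI[of _ C] exI[of _ "pt S"] conjI ballI) simp_all
qed

end

section \<open>The Markov property excludes asymptotic pairs\<close>

context compact_metric_action
begin

theorem no_asymptotic_pairs_if_topological_Markov_property:
  assumes min: "minimal_action G X \<phi>" and inf: "infinite (carrier G)"
    and exp: "expansive_action G X d \<phi>"
    and TMP: "topological_Markov_property G X d \<phi>"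
    and asym: "asymptotic_pair G X d \<phi> x y"
  shows "x = y"
proof (rule ccontr)
  assume "x \<noteq> y"
  have xy: "x \<in> topspace X" "y \<in> topspace X"
    using asym by (simp_all add: asymptotic_pair_def)
  obtain c where "0 < c" and c: "expansivity_constant c"
    using exp by (rule expansivity_constant_exists)
  \<comment> \<open>\<open>\<epsilon>\<close> comes first because \<open>\<delta>\<close> depends on
    it; \<open>\<kappa>\<close> is then chosen small against both.\<close>
  define \<epsilon> where "\<epsilon> = c / 16"
  have \<epsilon>: "0 < \<epsilon>" using \<open>0 < c\<close> by (simp add: \<epsilon>_def)
  then obtain \<delta> where "0 < \<delta>"
    and \<delta>: "\<forall>A. finite A \<and> A \<subseteq> carrier G \<longrightarrow> (\<exists>B. memory_set G X d \<phi> \<epsilon> \<delta> A B)"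
    using TMP unfolding topological_Markov_property_def by meson
  define \<kappa> where "\<kappa> = min \<delta> \<epsilon> / 3"
  have \<kappa>: "0 < \<kappa>" "3 * \<kappa> \<le> \<delta>" "3 * \<kappa> \<le> \<epsilon>"
    using \<open>0 < \<delta>\<close> \<epsilon> by (simp_all add: \<kappa>_def)
  have bounds: "\<epsilon> + 5 * \<kappa> \<le> c" "2 * \<epsilon> + 19 * \<kappa> \<le> c" "\<kappa> < c"
    using \<kappa> \<open>0 < c\<close> unfolding \<epsilon>_def by linarith+
  obtain F where F: "finite F" "F \<subseteq> carrier G" "\<one> \<in> F"
    and window: "\<forall>x\<in>topspace X. \<forall>y\<in>topspace X. (\<forall>f\<in>F. d (\<phi> f x) (\<phi> f y) \<le> c) \<longrightarrow> d x y \<le> \<kappa>"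
    using uniform_expansivity[OF c \<kappa>(1)] by (elim exE conjE)
  \<comment> \<open>Since \<open>\<delta>\<close> is uniform in \<open>A\<close>, the same constants
    and the same \<open>F\<close> serve both swap steps.\<close>
  have step: "swap_step G X \<phi> d c \<epsilon> \<kappa> F A B p q w"
    if "finite A" "A \<subseteq> carrier G" "p \<in> topspace X" "q \<in> topspace X" "w \<in> topspace X"
      "\<forall>h\<in>carrier G - A. d (\<phi> h p) (\<phi> h q) \<le> \<kappa>" "memory_set G X d \<phi> \<epsilon> \<delta> A B" for A B p q w
  proof unfold_locales
    show "d u v \<le> \<kappa>"
      if "u \<in> topspace X" "v \<in> topspace X" "\<And>f. f \<in> F \<Longrightarrow> d (\<phi> f u) (\<phi> f v) \<le> c" for u v
      using window that by simp
    show "memory_set G X d \<phi> \<epsilon> (3 * \<kappa>) A B"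
      using memory_set_mono that(7) \<kappa>(2) by blast
  qed (use F \<kappa> \<epsilon> bounds that in simp_all)
  obtain A where A: "finite A" "A \<subseteq> carrier G" "\<forall>h\<in>carrier G - A. d (\<phi> h x) (\<phi> h y) \<le> \<kappa>"
    using asym \<kappa>(1) unfolding asymptotic_pair_def by meson
  obtain a where a: "a \<in> carrier G" "c < d (\<phi> a x) (\<phi> a y)"
    using c xy \<open>x \<noteq> y\<close> unfolding expansivity_constant_def by (meson not_less)
  have "a \<in> A"
  proof (rule ccontr)
    assume "a \<notin> A"
    then have "d (\<phi> a x) (\<phi> a y) \<le> \<kappa>" using A(3) a(1) by simp
    then show False using a(2) bounds(3) by simp
  qed
  obtain B where "memory_set G X d \<phi> \<epsilon> \<delta> A B" using \<delta> A by meson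
  then interpret pair: swap_step G X \<phi> d c \<epsilon> \<kappa> F A B x y x
    using step A xy by blast
  obtain A' C z where A': "finite A'" "A' \<subseteq> carrier G" "A' \<noteq> {}" and C: "C \<subseteq> A'" and z: "z \<in> topspace X"
    and off: "\<forall>h\<in>carrier G - A'. d (\<phi> h z) (\<phi> h x) \<le> \<kappa>"
    and excl: "\<forall>e\<in>quot (F <#> quot F A') (quot F A') \<union> quot (quot F A') (F <#> quot F A').
       \<exists>t\<in>C. \<epsilon> + 7 * \<kappa> < d (\<phi> t (\<phi> e x)) (\<phi> t z)"
    using pair.exists_excluding_point[OF min inf refl \<open>a \<in> A\<close> a(2) bounds(2)] by (elim exE conjE)
  obtain B' where "memory_set G X d \<phi> \<epsilon> \<delta> A' B'" using \<delta> A' by meson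
  \<comment> \<open>The roles change: \<open>z\<close> is now the point to be replaced, and
    \<open>x\<close> replaces it.\<close>
  then interpret excluding: swap_step G X \<phi> d c \<epsilon> \<kappa> F A' B' z x x
    using step A' z xy off by blast
  have "C \<subseteq> excluding.N"
    using C excluding.A_subset_M excluding.M_subset_N by blast
  then show False
    using excluding.recurrence_not_excluded[OF min A'(3)] excl
    unfolding excluding.M_def excluding.N_def by blast
qed

end

theorem theorem5p1:
  fixes G :: "('g, 'm) monoid_scheme"
    and X :: "'x topology"
    and d :: "'x \<Rightarrow> 'x \<Rightarrow> real"
    and \<phi> :: "'g \<Rightarrow> 'x \<Rightarrow> 'x"
  assumes "group G" and "countable (carrier G)" and "infinite (carrier G)"
    and "compact_space X" and "metrizable_space X" and "compatible_metric X d"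
    and "action_by_homeos G X \<phi>"
    and "minimal_action G X \<phi>"
    and "expansive_action G X d \<phi>"
  shows "topological_Markov_property G X d \<phi> \<longleftrightarrow>
         \<not> (\<exists>x y. asymptotic_pair G X d \<phi> x y \<and> x \<noteq> y)"
proof -
  interpret group G by fact
  interpret group_action G "topspace X" \<phi>
    using assms(7) by (simp add: action_by_homeos_def)
  interpret Metric_space "topspace X" d
    using assms(6) by (simp add: compatible_metric_def)
  interpret compact_metric_action G X \<phi> d
    using assms(4,6,7) by unfold_locales (simp_all add: compatible_metric_def action_by_homeos_def)
  show ?thesis
    using topological_Markov_property_if_no_asymptotic_pairs[OF assms(9)]
      no_asymptotic_pairs_if_topological_Markov_property[OF assms(8,3,9)] by blast
qed

end
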